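(* Let $(X,T)$ be a topological dynamical system. Then the following conditions are equivalent: (1) $(X,T)$ is a weakly mixing M-system. (2) $Trans_{\mathcal F_{cen}}(X,T)$ is residual in $X$. (3) $(X,T)$ is $\mathcal F_{cen}$-point transitive.
   Context: A topological dynamical system (TDS) is a pair $(X,T)$ with $X$ a nonempty compact metric space and $T:X\to X$ continuous. "Opene" means nonempty open. For opene $U,V\subset X$ and $x\in X$: $N(U,V)=\{n\in\mathbb Z_+: U\cap T^{-n}V\ne\emptyset\}$, $N(x,U)=\{n\in\mathbb Z_+: T^nx\in U\}$. $(X,T)$ is transitive if $N(U,V)$ is infinite for all opene $U,V$, and weakly mixing if $(X\times X,T\times T)$ is transitive. A subsystem is a nonempty closed $Y\subset X$ with $TY\subset Y$; a system is minimal if it contains no proper subsystem; a minimal point is a point belonging to some minimal subsystem. An M-system is a transitive system with a dense set of minimal points. A pair $(x,y)\in X\times X$ is proximal if there is a sequence $\{n_i\}$ in $\mathbb N$ with $\lim_i T^{n_i}x=\lim_i T^{n_i}y$. A set $F\subset\mathbb Z_+$ is a central set if there exist a TDS $(Y,S)$, a point $x\in Y$, a minimal point $y\in Y$ and a neighborhood $U$ of $y$ such that $(x,y)$ is proximal and $N(x,U)\subset F$. $\mathcal F_{cen}$ is the family of all central sets. For a family $\mathcal F$ of subsets of $\mathbb Z_+$, $x\in X$ is an $\mathcal F$-transitive point if $N(x,U)\in\mathcal F$ for every opene $U$; the set of these is $Trans_{\mathcal F}(X,T)$, and $(X,T)$ is $\mathcal F$-point transitive if this set is nonempty. A set is residual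 if it contains a dense $G_\delta$ subset. *)

theory Defs
  imports "HOL-Analysis.Analysis"
begin

section \<open>Topological dynamical systems\<close>

text \<open>The map is a total HOL function; only its restriction to \<^term>\<open>mspace X\<close> matters.\<close>

definition tds :: "'a metric \<Rightarrow> ('a \<Rightarrow> 'a) \<Rightarrow> bool" where
  "tds X T \<longleftrightarrow> mspace X \<noteq> {} \<and> compact_space (mtopology_of X) \<and>
     continuous_map (mtopology_of X) (mtopology_of X) T"

definition opene :: "'a metric \<Rightarrow> 'a set \<Rightarrow> bool" where
  "opene X U \<longleftrightarrow> openin (mtopology_of X) U \<and> U \<noteq> {}"

definition hitting_times :: "('a \<Rightarrow> 'a) \<Rightarrow> 'a set \<Rightarrow> 'a set \<Rightarrow> nat set" where
  "hitting_times T U V = {n. U \<inter> (T ^^ n) -` V \<noteq> {}}"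

definition return_times :: "('a \<Rightarrow> 'a) \<Rightarrow> 'a \<Rightarrow> 'a set \<Rightarrow> nat set" where
  "return_times T x U = {n. (T ^^ n) x \<in> U}"

definition transitive_tds :: "'a metric \<Rightarrow> ('a \<Rightarrow> 'a) \<Rightarrow> bool" where
  "transitive_tds X T \<longleftrightarrow>
     (\<forall>U V. opene X U \<longrightarrow> opene X V \<longrightarrow> infinite (hitting_times T U V))"

definition weakly_mixing :: "'a metric \<Rightarrow> ('a \<Rightarrow> 'a) \<Rightarrow> bool" where
  "weakly_mixing X T \<longleftrightarrow> transitive_tds (prod_metric X X) (map_prod T T)"

definition subsystem :: "'a metric \<Rightarrow> ('a \<Rightarrow> 'a) \<Rightarrow> 'a set \<Rightarrow> bool" where
  "subsystem X T Y \<longleftrightarrow> Y \<noteq> {} \<and> closedin (mtopology_of X) Y \<and> T ` Y \<subseteq> Y"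

definition minimal_tds :: "'a metric \<Rightarrow> ('a \<Rightarrow> 'a) \<Rightarrow> bool" where
  "minimal_tds X T \<longleftrightarrow> \<not> (\<exists>Y. subsystem X T Y \<and> Y \<noteq> mspace X)"

definition minimal_point :: "'a metric \<Rightarrow> ('a \<Rightarrow> 'a) \<Rightarrow> 'a \<Rightarrow> bool" where
  "minimal_point X T x \<longleftrightarrow>
     (\<exists>Y. subsystem X T Y \<and> minimal_tds (submetric X Y) T \<and> x \<in> Y)"

definition M_system :: "'a metric \<Rightarrow> ('a \<Rightarrow> 'a) \<Rightarrow> bool" where
  "M_system X T \<longleftrightarrow> transitive_tds X T \<and>
     mtopology_of X closure_of {x. minimal_point X T x} = mspace X"

text \<open>The times \<open>n i\<close> form an arbitrary sequence of positive integers, not required to increase;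
  both limits exist and coincide.\<close>

definition proximal :: "'a metric \<Rightarrow> ('a \<Rightarrow> 'a) \<Rightarrow> 'a \<Rightarrow> 'a \<Rightarrow> bool" where
  "proximal X T x y \<longleftrightarrow> x \<in> mspace X \<and> y \<in> mspace X \<and>
     (\<exists>(n :: nat \<Rightarrow> nat) z. (\<forall>i. 0 < n i) \<and>
        limitin (mtopology_of X) (\<lambda>i. (T ^^ n i) x) z sequentially \<and>
        limitin (mtopology_of X) (\<lambda>i. (T ^^ n i) y) z sequentially)"


section \<open>Central sets\<close>

definition central_in :: "'a metric \<Rightarrow> ('a \<Rightarrow> 'a) \<Rightarrow> nat set \<Rightarrow> bool" where
  "central_in Y S F \<longleftrightarrow>
     (\<exists>x y U V. x \<in> mspace Y \<and> minimal_point Y S y \<and>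
        openin (mtopology_of Y) V \<and> y \<in> V \<and> V \<subseteq> U \<and> U \<subseteq> mspace Y \<and>
        proximal Y S x y \<and> return_times S x U \<subseteq> F)"

text \<open>The system \<open>(Y, S)\<close> ranges over all topological dynamical systems. HOL cannot quantify over
  the type of points, so the points are taken in \<^typ>\<open>nat \<Rightarrow> real\<close>, with an arbitrary carrier and an
  arbitrary metric on it. Nothing is lost: a compact metric space has at most continuum many points,
  so it is isometric to one of these; see \<open>central_inI\<close> below.\<close>

definition F_cen :: "nat set set" where
  "F_cen = {F. \<exists>(Y :: (nat \<Rightarrow> real) metric) S. tds Y S \<and> central_in Y S F}"


section \<open>Transitive points along a family\<close>

definition trans_points :: "nat set set \<Rightarrow> 'a metric \<Rightarrow> ('a \<Rightarrow> 'a) \<Rightarrow> 'a set" where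
  "trans_points \<F> X T = {x \<in> mspace X. \<forall>U. opene X U \<longrightarrow> return_times T x U \<in> \<F>}"

definition point_transitive :: "nat set set \<Rightarrow> 'a metric \<Rightarrow> ('a \<Rightarrow> 'a) \<Rightarrow> bool" where
  "point_transitive \<F> X T \<longleftrightarrow> trans_points \<F> X T \<noteq> {}"

definition residual_in :: "'a metric \<Rightarrow> 'a set \<Rightarrow> bool" where
  "residual_in X A \<longleftrightarrow> A \<subseteq> mspace X \<and>
     (\<exists>G. gdelta_in (mtopology_of X) G \<and> mtopology_of X closure_of G = mspace X \<and> G \<subseteq> A)"


section \<open>Central sets do not depend on the type of points\<close>

lemma compact_metric_injection:
  assumes "compact_space (mtopology_of (X :: 'a metric))"
  obtains e :: "'a \<Rightarrow> nat \<Rightarrow> real" where "inj_on e (mspace X)"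
proof (cases "mspace X = {}")
  case True
  then show ?thesis using that by simp
next
  case ne: False
  interpret Metric_space "mspace X" "mdist X" by simp
  have tb: "mtotally_bounded (mspace X)"
    using assms by (simp add: mtopology_of_def compact_space_eq_mcomplete_mtotally_bounded)
  have "\<exists>K. finite K \<and> K \<subseteq> mspace X \<and> mspace X \<subseteq> (\<Union>x\<in>K. mball x (inverse (Suc n)))" for n
    using tb unfolding mtotally_bounded_def by auto
  then obtain K where K: "\<And>n. finite (K n)" "\<And>n. K n \<subseteq> mspace X"
     "\<And>n. mspace X \<subseteq> (\<Union>x\<in>K n. mball x (inverse (Suc n)))"
    by metis
  define D where "D = (\<Union>n. K n)"
  have cD: "countable D" unfolding D_def using K(1) by (simp add: countable_finite)
  have "D \<noteq> {}"
    using ne K(3)[of 0] unfolding D_def by auto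
  then have "range (from_nat_into D) = D" using cD by (rule range_from_nat_into)
  then obtain q :: "nat \<Rightarrow> 'a" where q: "range q = D" by blast
  define e where "e = (\<lambda>x n. mdist X x (q n))"
  have "inj_on e (mspace X)"
  proof (rule inj_onI)
    fix x y assume x: "x \<in> mspace X" and y: "y \<in> mspace X" and eq: "e x = e y"
    have "mdist X x y \<le> 2 * \<epsilon>" if pos: "\<epsilon> > 0" for \<epsilon>
    proof -
      obtain n where n: "inverse (Suc n) < \<epsilon>" using reals_Archimedean[OF pos] by blast
      obtain k where k: "k \<in> K n" "mdist X k x < inverse (Suc n)" using K(3)[of n] x by auto
      then obtain m where m: "k = q m" using q unfolding D_def by blast
      have "mdist X x k = mdist X y k" using fun_cong[OF eq, of m] m unfolding e_def by simp
      moreover have "mdist X x y \<le> mdist X x k + mdist X k y"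
        using x y k(1) K(2)[of n] by (intro mdist_triangle) auto
      ultimately show ?thesis
        using k(2) n mdist_commute[of X k x] mdist_commute[of X k y] by linarith
    qed
    from this[of "mdist X x y / 4"] have "\<not> 0 < mdist X x y" by auto
    then have "mdist X x y = 0" using mdist_nonneg[of X x y] by linarith
    then show "x = y" using x y by simp
  qed
  then show ?thesis by (rule that)
qed

lemma central_inI:
  fixes X :: "'a metric"
  assumes tds: "tds X T" and cen: "central_in X T F"
  shows "F \<in> F_cen"
proof -
  obtain e :: "'a \<Rightarrow> nat \<Rightarrow> real" where inj: "inj_on e (mspace X)"
    using compact_metric_injection tds unfolding tds_def by metis
  define g where "g = inv_into (mspace X) e"
  have ge: "g (e x) = x" if "x \<in> mspace X" for x using that inj by (simp add: g_def)
  define d where "d = (\<lambda>u v. mdist X (g u) (g v))"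
  have met: "Metric_space (e ` mspace X) d"
    by standard (auto simp: d_def ge mdist_commute intro: mdist_triangle)
  define Y where "Y = metric (e ` mspace X, d)"
  have Ys: "mspace Y = e ` mspace X" and Yd: "mdist Y = d"
    using met by (simp_all add: Y_def Metric_space.mspace_metric Metric_space.mdist_metric)
  interpret Metric_space12 "mspace X" "mdist X" "mspace Y" "mdist Y"
    by (simp add: Metric_space12_mspace_mdist)
  have hom: "homeomorphic_map (mtopology_of X) (mtopology_of Y) e"
    unfolding mtopology_of_def
    by (rule isometry_imp_homeomorphic_map) (auto simp: Ys Yd d_def ge)
  have hom': "homeomorphic_map (mtopology_of Y) (mtopology_of X) g"
    unfolding mtopology_of_def
  proof (rule Metric_space12.isometry_imp_homeomorphic_map)
    show "g ` mspace Y = mspace X" by (auto simp: Ys ge image_image)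
  qed (rule Metric_space12_mspace_mdist, simp add: Yd d_def)
  define S where "S = e \<circ> T \<circ> g"
  have TX: "T x \<in> mspace X" if "x \<in> mspace X" for x
    using tds that unfolding tds_def continuous_map_def by auto
  have Se: "S (e x) = e (T x)" if "x \<in> mspace X" for x using that by (simp add: S_def ge)
  have TXn: "(T ^^ n) x \<in> mspace X" if "x \<in> mspace X" for n x
    by (induction n) (auto simp: that TX)
  have Sn: "(S ^^ n) (e x) = e ((T ^^ n) x)" if "x \<in> mspace X" for n x
    by (induction n) (auto simp: that Se TXn)
  have "compact_space (mtopology_of Y)"
    using tds hom homeomorphic_compact_space homeomorphic_map_imp_homeomorphic_space
    unfolding tds_def by blast
  moreover have "continuous_map (mtopology_of Y) (mtopology_of Y) S"
    using tds hom hom' unfolding tds_def S_def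
    by (meson continuous_map_compose homeomorphic_imp_continuous_map)
  ultimately have tdsY: "tds Y S" using tds by (simp add: tds_def Ys)
  have ssE: "subsystem X T (g ` W)" "g ` W \<subseteq> mspace X" "e ` (g ` W) = W"
    if "subsystem Y S W" for W
  proof -
    have W: "W \<noteq> {}" "closedin (mtopology_of Y) W" "S ` W \<subseteq> W" "W \<subseteq> mspace Y"
      using that closedin_subset unfolding subsystem_def by fastforce+
    show eg: "e ` (g ` W) = W" using W(4) by (force simp: Ys ge image_iff)
    show gW: "g ` W \<subseteq> mspace X" using W(4) by (auto simp: Ys ge)
    have "closedin (mtopology_of X) (g ` W)"
      using hom' W homeomorphic_map_closedness_eq by blast
    moreover have "T (g w) \<in> g ` W" if "w \<in> W" for w
    proof -
      have "S w = e (T (g w))" by (simp add: S_def)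
      then have "g (S w) = T (g w)" using gW that TX by (simp add: ge image_subset_iff)
      then show ?thesis using W(3) that by (metis image_eqI image_subset_iff)
    qed
    ultimately show "subsystem X T (g ` W)" using W(1) unfolding subsystem_def by auto
  qed
  have subsub: "subsystem (submetric X A) T B \<longleftrightarrow> subsystem X T B \<and> B \<subseteq> A"
    if "closedin (mtopology_of X) A" for X :: "'x metric" and T A B
    using that unfolding subsystem_def mtopology_of_submetric
    by (auto simp: closedin_closed_subtopology)
  have minY: "minimal_point Y S (e y)" if "minimal_point X T y" for y
  proof -
    obtain A where A: "subsystem X T A" "minimal_tds (submetric X A) T" "y \<in> A"
      using \<open>minimal_point X T y\<close> unfolding minimal_point_def by blast
    have AX: "A \<subseteq> mspace X" "closedin (mtopology_of X) A" "T ` A \<subseteq> A"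
      using A(1) closedin_subset unfolding subsystem_def by fastforce+
    have cl: "closedin (mtopology_of Y) (e ` A)"
      using hom AX homeomorphic_map_closedness_eq by blast
    have "S (e a) \<in> e ` A" if "a \<in> A" for a
      using AX that by (auto simp: Se subset_iff)
    then have 1: "subsystem Y S (e ` A)" using cl A(1) unfolding subsystem_def by auto
    have "W = e ` A" if "subsystem Y S W" "W \<subseteq> e ` A" for W
    proof -
      have "g ` W \<subseteq> A" using that(2) AX ge by force
      then have "subsystem (submetric X A) T (g ` W)"
        using subsub[OF AX(2)] ssE(1)[OF that(1)] by blast
      then have "g ` W = A" using A(2) AX(1) unfolding minimal_tds_def mspace_submetric by blast
      then show ?thesis using ssE(3)[OF that(1)] by simp
    qed
    moreover have "e ` A \<inter> mspace Y = e ` A" using AX(1) by (auto simp: Ys)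
    ultimately have "minimal_tds (submetric Y (e ` A)) S"
      unfolding minimal_tds_def subsub[OF cl] by auto
    with 1 A(3) show ?thesis unfolding minimal_point_def by blast
  qed
  have lim: "limitin (mtopology_of Y) (\<lambda>i. (S ^^ n i) (e x)) (e z) sequentially"
    if "x \<in> mspace X" "limitin (mtopology_of X) (\<lambda>i. (T ^^ n i) x) z sequentially"
    for n :: "nat \<Rightarrow> nat" and x z
    using continuous_map_limit[OF homeomorphic_imp_continuous_map[OF hom] that(2)]
    by (simp add: Sn[OF that(1)] o_def)
  obtain x y U V where *: "x \<in> mspace X" "minimal_point X T y"
     "openin (mtopology_of X) V" "y \<in> V" "V \<subseteq> U" "U \<subseteq> mspace X"
     "proximal X T x y" "return_times T x U \<subseteq> F"
    using cen unfolding central_in_def by blast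
  have "proximal Y S (e x) (e y)"
    using *(7) lim unfolding proximal_def Ys by blast
  moreover have "openin (mtopology_of Y) (e ` V)"
    using hom * homeomorphic_map_openness_eq by blast
  moreover have "return_times S (e x) (e ` U) \<subseteq> F"
  proof -
    have "(T ^^ n) x \<in> U" if "(S ^^ n) (e x) \<in> e ` U" for n
      using that *(6) TXn[OF *(1)] by (auto simp: Sn[OF *(1)] dest!: inj_onD[OF inj])
    then show ?thesis using *(8) unfolding return_times_def by auto
  qed
  ultimately have "central_in Y S F"
    unfolding central_in_def using * minY
    by (intro exI[of _ "e x"] exI[of _ "e y"] exI[of _ "e ` U"] exI[of _ "e ` V"])
       (auto simp: Ys)
  with tdsY show ?thesis unfolding F_cen_def by blast
qed

end

theory Submission
  imports Defs
begin

text \<open>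
  If the system is weakly mixing, then for every \<open>y\<close> the points proximal to \<open>y\<close> form a residual set:
  given an open set \<open>U\<close> and a finite cover by small balls, some \<open>n\<close> brings a point of \<open>U\<close> into each of
  the balls, hence close to \<open>T\<^sup>n y\<close>. A point proximal to all members of a countable dense set of minimal
  points is \<open>F_cen\<close>-transitive.

  Conversely, let \<open>x\<close> be \<open>F_cen\<close>-transitive. Lifting to the product with the system that witnesses the
  centrality of \<open>N(x, U)\<close> produces a minimal point in the closure of \<open>U\<close>. As \<open>U\<close> contains a minimal
  point, \<open>N(U, U)\<close> contains the difference set of a syndetic set. A central set contains all differences
  of arbitrarily long sequences, so by pigeonhole it meets \<open>N(U, U)\<close>; after moving \<open>x\<close> into \<open>U\<close>, this
  shows that \<open>N(U, U)\<close> and \<open>N(U, V)\<close> intersect, which implies weak mixing.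
\<close>

section \<open>Minimal sets\<close>

text \<open>The map is total on the type, so a plain preimage could contain points outside
  \<open>mspace X\<close>; cutting down to the carrier is what makes preimages of open sets
  open.\<close>

definition preimage_in :: "'a metric \<Rightarrow> ('a \<Rightarrow> 'a) \<Rightarrow> nat \<Rightarrow> 'a set \<Rightarrow> 'a set" where
  "preimage_in X T n V = {x \<in> mspace X. (T ^^ n) x \<in> V}"

definition orbit_closure :: "'a metric \<Rightarrow> ('a \<Rightarrow> 'a) \<Rightarrow> 'a \<Rightarrow> 'a set" where
  "orbit_closure X T x = mtopology_of X closure_of range (\<lambda>n. (T ^^ n) x)"

text \<open>Minimality is phrased inside the ambient system, so that minimal sets can be compared,
  mapped and intersected without passing to \<open>submetric\<close>.\<close>

definition minimal_set :: "'a metric \<Rightarrow> ('a \<Rightarrow> 'a) \<Rightarrow> 'a set \<Rightarrow> bool" where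
  "minimal_set X T M \<longleftrightarrow> subsystem X T M \<and> (\<forall>N\<subseteq>M. subsystem X T N \<longrightarrow> N = M)"

lemma continuous_map_funpow:
  assumes "tds X T"
  shows "continuous_map (mtopology_of X) (mtopology_of X) (T ^^ n)"
proof (induction n)
  case (Suc n)
  have "continuous_map (mtopology_of X) (mtopology_of X) (T \<circ> T ^^ n)"
    by (rule continuous_map_compose[OF Suc]) (use assms in \<open>simp add: tds_def\<close>)
  then show ?case by (simp add: o_def)
qed simp

lemma funpow_in_mspace: "tds X T \<Longrightarrow> x \<in> mspace X \<Longrightarrow> (T ^^ n) x \<in> mspace X"
  using continuous_map_funpow[of X T n] by (fastforce simp: continuous_map_def)

lemma openin_preimage_in:
  "tds X T \<Longrightarrow> openin (mtopology_of X) V \<Longrightarrow> openin (mtopology_of X) (preimage_in X T n V)"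
  unfolding preimage_in_def
  using openin_continuous_map_preimage[OF continuous_map_funpow] by fastforce

lemma Hausdorff_mtopology_of: "Hausdorff_space (mtopology_of X)"
  by (simp add: mtopology_of_def Metric_space.Hausdorff_space_mtopology)

lemma subsystem_subset: "subsystem X T Y \<Longrightarrow> Y \<subseteq> mspace X"
  unfolding subsystem_def using closedin_subset by fastforce

lemma subsystem_funpow: "subsystem X T Y \<Longrightarrow> y \<in> Y \<Longrightarrow> (T ^^ n) y \<in> Y"
  unfolding subsystem_def by (induction n) auto

text \<open>A subsystem \<open>M\<close> is closed, so the closed subsets of the subspace
  \<open>M\<close> are the closed subsets of \<open>X\<close> lying in \<open>M\<close>, and the two
  notions of subsystem agree there.\<close>

lemma minimal_point_iff: "minimal_point X T x \<longleftrightarrow> (\<exists>M. minimal_set X T M \<and> x \<in> M)"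
proof -
  have "minimal_tds (submetric X M) T \<longleftrightarrow> (\<forall>N\<subseteq>M. subsystem X T N \<longrightarrow> N = M)"
    if M: "subsystem X T M" for M
  proof -
    have cl: "closedin (mtopology_of X) M" using M by (simp add: subsystem_def)
    then have "subsystem (submetric X M) T N \<longleftrightarrow> subsystem X T N \<and> N \<subseteq> M" for N
      unfolding subsystem_def mtopology_of_submetric
      by (auto simp: closedin_closed_subtopology)
    moreover have "M \<inter> mspace X = M" using subsystem_subset[OF M] by blast
    ultimately show ?thesis unfolding minimal_tds_def by (auto simp: Int_commute)
  qed
  then show ?thesis unfolding minimal_point_def minimal_set_def by blast
qed

text \<open>Zorn's lemma applies because compactness keeps the intersection of a chain of subsystems
  nonempty.\<close>

lemma ex_minimal_set:
  assumes tds: "tds X T" and A: "subsystem X T A"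
  obtains M where "M \<subseteq> A" "minimal_set X T M"
proof -
  \<comment> \<open>Taking complements turns minimal subsystems into maximal elements, which is what
    Zorn's lemma delivers.\<close>
  define \<A> where "\<A> = {- N |N. subsystem X T N \<and> N \<subseteq> A}"
  have "\<exists>M\<in>\<A>. \<forall>B\<in>\<A>. M \<subseteq> B \<longrightarrow> B = M"
  proof (rule subset_Zorn_nonempty)
    show "\<A> \<noteq> {}" using A unfolding \<A>_def by blast
  next
    fix \<C> assume ne: "\<C> \<noteq> {}" and ch: "subset.chain \<A> \<C>"
    define \<N> where "\<N> = uminus ` \<C>"
    have sub: "subsystem X T N" "N \<subseteq> A" if "N \<in> \<N>" for N
      using that ch unfolding \<N>_def \<A>_def subset.chain_def by auto
    have tot: "N \<subseteq> N' \<or> N' \<subseteq> N" if "N \<in> \<N>" "N' \<in> \<N>" for N N'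
    proof -
      have "- N \<in> \<C>" "- N' \<in> \<C>" using that unfolding \<N>_def by auto
      then have "- N \<subseteq> - N' \<or> - N' \<subseteq> - N" using ch unfolding subset_chain_def by meson
      then show ?thesis by blast
    qed
    \<comment> \<open>A finite nonempty part of the chain has a least member, which is nonempty;
      this gives the finite intersection property.\<close>
    have min: "\<exists>N\<in>\<F>. \<forall>N'\<in>\<F>. N \<subseteq> N'" if "finite \<F>" "\<F> \<noteq> {}" "\<F> \<subseteq> \<N>" for \<F>
      using that
    proof (induction rule: finite_ne_induct)
      case (insert N \<F>)
      then obtain N0 where N0: "N0 \<in> \<F>" "\<forall>N'\<in>\<F>. N0 \<subseteq> N'" by blast
      have "N \<in> \<N>" "N0 \<in> \<N>" using insert.prems N0(1) by blast+
      from tot[OF this] show ?case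
      proof
        assume "N \<subseteq> N0"
        then have "\<forall>N'\<in>insert N \<F>. N \<subseteq> N'" using N0(2) by auto
        then show ?thesis by blast
      next
        assume "N0 \<subseteq> N"
        then have "\<forall>N'\<in>insert N \<F>. N0 \<subseteq> N'" using N0(2) by auto
        then show ?thesis using N0(1) by blast
      qed
    qed simp
    have "\<Inter>\<F> \<noteq> {}" if \<F>: "finite \<F>" "\<F> \<subseteq> \<N>" for \<F>
    proof (cases "\<F> = {}")
      case False
      then obtain N where N: "N \<in> \<F>" "\<forall>N'\<in>\<F>. N \<subseteq> N'"
        using min[OF \<F>(1) _ \<F>(2)] by blast
      then have "N \<noteq> {}" using sub(1)[of N] \<F>(2) unfolding subsystem_def by blast
      then show ?thesis using N(2) by blast
    qed simp
    moreover have "compact_space (mtopology_of X)" using tds by (simp add: tds_def)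
    moreover have cl: "\<forall>N\<in>\<N>. closedin (mtopology_of X) N" using sub(1) unfolding subsystem_def by blast
    ultimately have "\<Inter>\<N> \<noteq> {}" by (simp add: compact_space_fip)
    moreover have "closedin (mtopology_of X) (\<Inter>\<N>)"
      using ne cl by (intro closedin_Inter) (auto simp: \<N>_def)
    moreover have "T ` \<Inter>\<N> \<subseteq> \<Inter>\<N>" using sub(1) unfolding subsystem_def by blast
    ultimately have "subsystem X T (\<Inter>\<N>)" by (simp add: subsystem_def)
    moreover have "\<Inter>\<N> \<subseteq> A" using ne sub(2) unfolding \<N>_def by blast
    moreover have "\<Union>\<C> = - \<Inter>\<N>" unfolding \<N>_def by auto
    ultimately show "\<Union>\<C> \<in> \<A>" unfolding \<A>_def by blast
  qed
  then obtain B where "B \<in> \<A>" and max: "\<And>C. C \<in> \<A> \<Longrightarrow> B \<subseteq> C \<Longrightarrow> C = B" by auto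
  then obtain M where M: "subsystem X T M" "M \<subseteq> A" "B = - M" unfolding \<A>_def by auto
  have "N = M" if "N \<subseteq> M" "subsystem X T N" for N
  proof -
    have "- N \<in> \<A>" using that M(2) unfolding \<A>_def by auto
    then show ?thesis using max[of "- N"] that(1) M(3) by simp
  qed
  then have "minimal_set X T M" unfolding minimal_set_def using M(1) by simp
  with M(2) show ?thesis by (rule that)
qed

lemma subsystem_orbit_closure:
  assumes tds: "tds X T" and x: "x \<in> mspace X"
  shows "subsystem X T (orbit_closure X T x)"
proof -
  have "T ` orbit_closure X T x \<subseteq> mtopology_of X closure_of (T ` range (\<lambda>n. (T ^^ n) x))"
    unfolding orbit_closure_def
    by (rule continuous_map_image_closure_subset) (use tds in \<open>simp add: tds_def\<close>)
  also have "\<dots> \<subseteq> orbit_closure X T x"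
    unfolding orbit_closure_def
    by (rule closure_of_mono) (auto intro: range_eqI[of _ _ "Suc _"])
  finally have "T ` orbit_closure X T x \<subseteq> orbit_closure X T x" .
  moreover have "range (\<lambda>n. (T ^^ n) x) \<subseteq> orbit_closure X T x"
    unfolding orbit_closure_def
    by (rule closure_of_subset) (use funpow_in_mspace[OF tds x] in auto)
  ultimately show ?thesis
    unfolding subsystem_def by (auto simp: orbit_closure_def)
qed

lemma orbit_closure_refl: "x \<in> mspace X \<Longrightarrow> x \<in> orbit_closure X T x"
  unfolding orbit_closure_def in_closure_of by (auto intro: exI[of _ 0])

lemma orbit_closure_minimal:
  assumes "subsystem X T A" "x \<in> A"
  shows "orbit_closure X T x \<subseteq> A"
  unfolding orbit_closure_def
  by (rule closure_of_minimal)
     (use assms subsystem_funpow[OF assms] in \<open>auto simp: subsystem_def\<close>)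

text \<open>The orbit closure of \<open>y\<close> is a subsystem inside \<open>M\<close>, hence all
  of \<open>M\<close>; an open set that meets it meets the orbit itself.\<close>

lemma minimal_set_visits:
  assumes tds: "tds X T" and M: "minimal_set X T M" and y: "y \<in> M"
    and W: "openin (mtopology_of X) W" "W \<inter> M \<noteq> {}"
  shows "\<exists>n. (T ^^ n) y \<in> W"
proof -
  have sM: "subsystem X T M" using M by (simp add: minimal_set_def)
  have "subsystem X T (orbit_closure X T y)"
    using subsystem_orbit_closure[OF tds] subsystem_subset[OF sM] y by blast
  then have "orbit_closure X T y = M"
    using M orbit_closure_minimal[OF sM y] unfolding minimal_set_def by blast
  then obtain z where "z \<in> W" "z \<in> mtopology_of X closure_of range (\<lambda>n. (T ^^ n) y)"
    using W(2) unfolding orbit_closure_def by blast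
  then show ?thesis using W(1) unfolding in_closure_of by blast
qed

text \<open>The preimages of \<open>W\<close> cover the compact set \<open>M\<close>, and a finite
  subcover bounds the waiting time uniformly in \<open>y\<close>. In particular the visits of each
  orbit in \<open>M\<close> to \<open>W\<close> are syndetic.\<close>

lemma minimal_set_syndetic:
  assumes tds: "tds X T" and M: "minimal_set X T M"
    and W: "openin (mtopology_of X) W" "W \<inter> M \<noteq> {}"
  obtains g where "\<And>y. y \<in> M \<Longrightarrow> \<exists>r<g. (T ^^ r) y \<in> W"
proof -
  have sM: "subsystem X T M" using M by (simp add: minimal_set_def)
  have "compactin (mtopology_of X) M"
    using tds sM closedin_compact_space unfolding tds_def subsystem_def by blast
  moreover have "M \<subseteq> \<Union>(range (\<lambda>n. preimage_in X T n W))"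
    using minimal_set_visits[OF tds M _ W] subsystem_subset[OF sM]
    unfolding preimage_in_def by blast
  ultimately obtain \<F> where \<F>: "finite \<F>" "\<F> \<subseteq> range (\<lambda>n. preimage_in X T n W)" "M \<subseteq> \<Union>\<F>"
    using compactinD[of "mtopology_of X" M "range (\<lambda>n. preimage_in X T n W)"]
      openin_preimage_in[OF tds W(1)] by blast
  then obtain I where I: "finite I" "\<F> = (\<lambda>n. preimage_in X T n W) ` I"
    by (meson finite_subset_image)
  obtain g where g: "\<And>r. r \<in> I \<Longrightarrow> r < g" using I(1) unfolding finite_nat_set_iff_bounded by blast
  show ?thesis
  proof
    fix y assume "y \<in> M"
    then obtain r where "r \<in> I" "(T ^^ r) y \<in> W" using \<F>(3) unfolding I(2) preimage_in_def by blast
    then show "\<exists>r<g. (T ^^ r) y \<in> W" using g by blast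
  qed
qed

section \<open>Factor maps and products of systems\<close>

lemma subsystem_image:
  assumes X: "tds X T" and h: "continuous_map (mtopology_of X) (mtopology_of Y) h"
    and eq: "\<And>x. x \<in> mspace X \<Longrightarrow> h (T x) = S (h x)" and A: "subsystem X T A"
  shows "subsystem Y S (h ` A)"
proof -
  have "compactin (mtopology_of X) A"
    using X A closedin_compact_space unfolding tds_def subsystem_def by blast
  then have "closedin (mtopology_of Y) (h ` A)"
    using h image_compactin compactin_imp_closedin Hausdorff_mtopology_of by blast
  moreover have "S (h a) \<in> h ` A" if "a \<in> A" for a
    using eq[of a] that A subsystem_subset[OF A] unfolding subsystem_def by (metis image_eqI image_subset_iff subsetD)
  ultimately show ?thesis using A unfolding subsystem_def by auto
qed

lemma subsystem_preimage:
  assumes h: "continuous_map (mtopology_of X) (mtopology_of Y) h"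
    and eq: "\<And>x. x \<in> mspace X \<Longrightarrow> h (T x) = S (h x)" and A: "subsystem X T A"
    and B: "subsystem Y S B" and ne: "B \<inter> h ` A \<noteq> {}"
  shows "subsystem X T {a \<in> A. h a \<in> B}"
proof -
  have AX: "A \<subseteq> mspace X" by (rule subsystem_subset[OF A])
  have "closedin (mtopology_of X) {x \<in> topspace (mtopology_of X). h x \<in> B}"
    using closedin_continuous_map_preimage[OF h] B unfolding subsystem_def by blast
  moreover have "{a \<in> A. h a \<in> B} = A \<inter> {x \<in> topspace (mtopology_of X). h x \<in> B}" using AX by auto
  ultimately have "closedin (mtopology_of X) {a \<in> A. h a \<in> B}"
    using A closedin_Int unfolding subsystem_def by metis
  moreover have "h (T a) \<in> B" if "a \<in> A" "h a \<in> B" for a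
    using that eq[of a] AX B unfolding subsystem_def by auto
  ultimately show ?thesis using A ne unfolding subsystem_def by auto
qed

text \<open>A subsystem of the image pulls back to a subsystem of \<open>M\<close>, which by
  minimality is \<open>M\<close>; so it was the whole image.\<close>

lemma minimal_set_image:
  assumes X: "tds X T" and h: "continuous_map (mtopology_of X) (mtopology_of Y) h"
    and eq: "\<And>x. x \<in> mspace X \<Longrightarrow> h (T x) = S (h x)" and M: "minimal_set X T M"
  shows "minimal_set Y S (h ` M)"
  unfolding minimal_set_def
proof (intro conjI allI impI)
  have sM: "subsystem X T M" using M by (simp add: minimal_set_def)
  show "subsystem Y S (h ` M)" by (rule subsystem_image[OF X h eq sM])
  fix N assume N: "N \<subseteq> h ` M" "subsystem Y S N"
  then have "N \<inter> h ` M \<noteq> {}" unfolding subsystem_def by blast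
  then have "subsystem X T {a \<in> M. h a \<in> N}" using subsystem_preimage[OF h eq sM N(2)] by blast
  then have "{a \<in> M. h a \<in> N} = M" using M unfolding minimal_set_def by auto
  then show "N = h ` M" using N(1) by blast
qed

lemma tds_prod_metric:
  assumes "tds X T" "tds Y S"
  shows "tds (prod_metric X Y) (map_prod T S)"
proof -
  let ?X = "mtopology_of X" and ?Y = "mtopology_of Y"
  have "continuous_map (prod_topology ?X ?Y) ?X (T \<circ> fst)"
    "continuous_map (prod_topology ?X ?Y) ?Y (S \<circ> snd)"
    using assms unfolding tds_def
    by (blast intro: continuous_map_compose continuous_map_fst continuous_map_snd)+
  then have "continuous_map (prod_topology ?X ?Y) (prod_topology ?X ?Y) (map_prod T S)"
    using continuous_map_pairedI[of "prod_topology ?X ?Y" ?X "T \<circ> fst" ?Y "S \<circ> snd"]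
    by (simp add: map_prod_def case_prod_unfold o_def)
  then show ?thesis using assms by (simp add: tds_def compact_space_prod_topology)
qed

lemma map_prod_funpow:
  fixes T :: "'a \<Rightarrow> 'a" and S :: "'b \<Rightarrow> 'b"
  shows "(map_prod T S ^^ n) (x, y) = ((T ^^ n) x, (S ^^ n) y)"
  by (induction n) simp_all

section \<open>Central sets\<close>

text \<open>The common limit \<open>z\<close> lies in the minimal set of \<open>y\<close>, so some
  iterate \<open>(T ^^ m) z\<close> enters \<open>W\<close>. By continuity the same \<open>m\<close>
  further steps bring both orbits into \<open>W\<close> once they are close to
  \<open>z\<close>.\<close>

lemma proximal_minimal_visits:
  assumes tds: "tds X T" and prox: "proximal X T x y" and min: "minimal_point X T y"
    and W: "openin (mtopology_of X) W" "y \<in> W"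
  shows "\<exists>n>0. (T ^^ n) x \<in> W \<and> (T ^^ n) y \<in> W"
proof -
  obtain M where M: "minimal_set X T M" "y \<in> M" using min unfolding minimal_point_iff by blast
  have sM: "subsystem X T M" using M by (simp add: minimal_set_def)
  obtain n :: "nat \<Rightarrow> nat" and z where n: "\<forall>i. 0 < n i"
    and lx: "limitin (mtopology_of X) (\<lambda>i. (T ^^ n i) x) z sequentially"
    and ly: "limitin (mtopology_of X) (\<lambda>i. (T ^^ n i) y) z sequentially"
    using prox unfolding proximal_def by (elim conjE exE) (rule that)
  have "z \<in> M"
    using limitin_closedin[OF ly, of M] sM subsystem_funpow[OF sM M(2)]
    unfolding subsystem_def by auto
  then obtain m where m: "(T ^^ m) z \<in> W" using minimal_set_visits[OF tds M(1)] W M(2) by blast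
  then have "z \<in> preimage_in X T m W"
    using \<open>z \<in> M\<close> subsystem_subset[OF sM] unfolding preimage_in_def by blast
  then have "eventually (\<lambda>i. (T ^^ n i) x \<in> preimage_in X T m W \<and>
      (T ^^ n i) y \<in> preimage_in X T m W) sequentially"
    using lx ly openin_preimage_in[OF tds W(1)] unfolding limitin_def
    by (simp add: eventually_conj)
  then obtain i where "(T ^^ n i) x \<in> preimage_in X T m W" "(T ^^ n i) y \<in> preimage_in X T m W"
    by (auto simp: eventually_sequentially)
  then have "(T ^^ (m + n i)) x \<in> W \<and> (T ^^ (m + n i)) y \<in> W"
    by (simp add: preimage_in_def funpow_add)
  \<comment> \<open>Here \<open>m\<close> may be zero; positivity of the time comes from
    \<open>n i\<close>.\<close>
  then show ?thesis using n by (intro exI[of _ "m + n i"]) auto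
qed

text \<open>The sequence consists of the partial sums of an IP set: each new generator is a common return
  time of \<open>x\<close> and \<open>y\<close> to a neighbourhood of \<open>y\<close>, which is then shrunk accordingly.\<close>

lemma proximal_minimal_differences:
  assumes tds: "tds X T" and prox: "proximal X T x y" and min: "minimal_point X T y"
  shows "openin (mtopology_of X) W \<Longrightarrow> y \<in> W \<Longrightarrow>
    \<exists>s :: nat \<Rightarrow> nat. s 0 = 0 \<and> (\<forall>j\<le>L. \<forall>i<j. s i < s j \<and> (T ^^ (s j - s i)) x \<in> W)"
proof (induction L arbitrary: W)
  case 0
  show ?case by (intro exI[of _ "\<lambda>_. 0"]) simp
next
  case (Suc L)
  obtain n where n: "n > 0" "(T ^^ n) x \<in> W" "(T ^^ n) y \<in> W"
    using proximal_minimal_visits[OF tds prox min Suc.prems] by blast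
  \<comment> \<open>If \<open>k\<close> is a time at which \<open>x\<close> visits
    \<open>W'\<close>, then \<open>x\<close> visits \<open>W\<close> both at time \<open>k\<close>
    and at time \<open>n + k\<close>. The old sequence can thus be shifted by \<open>n\<close> and
    preceded by 0.\<close>
  define W' where "W' = W \<inter> preimage_in X T n W"
  have "openin (mtopology_of X) W'"
    unfolding W'_def by (intro openin_Int openin_preimage_in[OF tds] Suc.prems)
  moreover have "y \<in> W'"
    using Suc.prems n(3) prox unfolding W'_def preimage_in_def proximal_def by blast
  ultimately obtain s where s: "s 0 = 0"
    "\<And>i j. j \<le> L \<Longrightarrow> i < j \<Longrightarrow> s i < s j \<and> (T ^^ (s j - s i)) x \<in> W'"
    using Suc.IH[of W'] by metis
  define s' where "s' = case_nat 0 (\<lambda>i. n + s i)"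
  have "s' i < s' j \<and> (T ^^ (s' j - s' i)) x \<in> W" if ij: "j \<le> Suc L" "i < j" for i j
  proof -
    obtain j' where j': "j = Suc j'" "j' \<le> L" using ij by (cases j) auto
    show ?thesis
    proof (cases i)
      case 0
      \<comment> \<open>For \<open>j' = 0\<close> the time is \<open>n\<close> itself, which was
        chosen as a visit to \<open>W\<close>; otherwise \<open>s j'\<close> is a difference from
        \<open>s 0 = 0\<close>, so it is a visit to \<open>W'\<close>.\<close>
      have "(T ^^ (n + s j')) x \<in> W"
      proof (cases "j' = 0")
        case False
        then have "(T ^^ s j') x \<in> preimage_in X T n W" using s(2)[of j' 0] s(1) j' W'_def by auto
        then show ?thesis by (simp add: preimage_in_def funpow_add)
      qed (use s n in simp)
      then show ?thesis using 0 j' n(1) by (simp add: s'_def)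
    next
      case (Suc i')
      then show ?thesis using s(2)[of j' i'] ij j' by (simp add: s'_def W'_def)
    qed
  qed
  moreover have "s' 0 = 0" by (simp add: s'_def)
  ultimately show ?case by blast
qed

lemma F_cen_differences:
  assumes "F \<in> F_cen"
  shows "\<exists>s :: nat \<Rightarrow> nat. s 0 = 0 \<and> (\<forall>j\<le>L. \<forall>i<j. s i < s j \<and> s j - s i \<in> F)"
proof -
  obtain Y :: "(nat \<Rightarrow> real) metric" and S where "tds Y S" "central_in Y S F"
    using assms unfolding F_cen_def by blast
  then obtain x y V where "minimal_point Y S y" "openin (mtopology_of Y) V" "y \<in> V"
    "proximal Y S x y" "return_times S x V \<subseteq> F"
    unfolding central_in_def return_times_def by blast
  then obtain s :: "nat \<Rightarrow> nat" where s: "s 0 = 0"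
    "\<forall>j\<le>L. \<forall>i<j. s i < s j \<and> (S ^^ (s j - s i)) x \<in> V"
    using proximal_minimal_differences[OF \<open>tds Y S\<close>, of x y V L] by metis
  moreover have "n \<in> F" if "(S ^^ n) x \<in> V" for n
    using that \<open>return_times S x V \<subseteq> F\<close> unfolding return_times_def by blast
  ultimately show ?thesis by (intro exI[of _ s]) simp
qed

text \<open>Since \<open>s 0 = 0\<close>, the term \<open>s (Suc N)\<close> is itself one of the
  differences, and strict growth makes it at least \<open>Suc N\<close>.\<close>

lemma F_cen_unbounded:
  assumes "F \<in> F_cen"
  shows "\<exists>n\<ge>N. n \<in> F"
proof -
  obtain s :: "nat \<Rightarrow> nat" where s: "s 0 = 0" 
    "\<And>i j. j \<le> Suc N \<Longrightarrow> i < j \<Longrightarrow> s i < s j \<and> s j - s i \<in> F"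
    using F_cen_differences[OF assms, of "Suc N"] by auto
  have "i \<le> s i" if "i \<le> Suc N" for i
    using that
  proof (induction i)
    case (Suc i)
    then show ?case using s(2)[of "Suc i" i] by simp
  qed simp
  then have "Suc N \<le> s (Suc N)" by blast
  then show ?thesis using s(2)[of "Suc N" 0] s(1) by (intro exI[of _ "s (Suc N)"]) auto
qed

text \<open>Pass to the orbit closure of \<open>(x, x')\<close> in \<open>X \<times> Y\<close>, where \<open>x'\<close> is proximal to the minimal point
  \<open>y\<close>: it meets the fibre over \<open>y\<close>, hence contains a minimal point \<open>(v, y)\<close>.\<close>

lemma F_cen_return_minimal_point:
  assumes X: "tds X T" and x: "x \<in> mspace X" and F: "return_times T x U \<in> F_cen"
  obtains v where "minimal_point X T v" "v \<in> mtopology_of X closure_of U"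
proof -
  obtain Y :: "(nat \<Rightarrow> real) metric" and S where Y: "tds Y S" "central_in Y S (return_times T x U)"
    using F unfolding F_cen_def by blast
  then obtain x' y V where *: "x' \<in> mspace Y" "minimal_point Y S y" "openin (mtopology_of Y) V" "y \<in> V"
    "proximal Y S x' y" and ret: "return_times S x' V \<subseteq> return_times T x U"
    unfolding central_in_def return_times_def by blast
  obtain M' where M': "minimal_set Y S M'" "y \<in> M'" using *(2) unfolding minimal_point_iff by blast
  have sM': "subsystem Y S M'" using M' by (simp add: minimal_set_def)
  let ?P = "prod_metric X Y" and ?R = "map_prod T S"
  have P: "tds ?P ?R" by (rule tds_prod_metric[OF X Y(1)])
  have fst: "continuous_map (mtopology_of ?P) (mtopology_of X) fst"
    and snd: "continuous_map (mtopology_of ?P) (mtopology_of Y) snd"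
    by (simp_all add: continuous_map_fst continuous_map_snd)
  define Z where "Z = orbit_closure ?P ?R (x, x')"
  have xx: "(x, x') \<in> mspace ?P" using x *(1) by simp
  have Z: "subsystem ?P ?R Z" unfolding Z_def by (rule subsystem_orbit_closure[OF P xx])
  have sndZ: "subsystem Y S (snd ` Z)" by (rule subsystem_image[OF P snd _ Z]) auto
  have "x' \<in> snd ` Z" using orbit_closure_refl[OF xx] unfolding Z_def by force
  then have "orbit_closure Y S x' \<subseteq> snd ` Z" using orbit_closure_minimal[OF sndZ] by blast
  moreover have "y \<in> orbit_closure Y S x'"
    unfolding orbit_closure_def in_closure_of
  proof (intro conjI allI impI)
    show "y \<in> topspace (mtopology_of Y)" using *(5) by (simp add: proximal_def)
    fix W assume "y \<in> W \<and> openin (mtopology_of Y) W"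
    then show "\<exists>z. z \<in> range (\<lambda>n. (S ^^ n) x') \<and> z \<in> W"
      using proximal_minimal_visits[OF Y(1) *(5,2), of W] by blast
  qed
  ultimately have "M' \<inter> snd ` Z \<noteq> {}" using M'(2) by blast
  then have "subsystem ?P ?R {z \<in> Z. snd z \<in> M'}"
    by (intro subsystem_preimage[OF snd _ Z sM']) auto
  then obtain M where M: "M \<subseteq> {z \<in> Z. snd z \<in> M'}" "minimal_set ?P ?R M"
    by (rule ex_minimal_set[OF P])
  \<comment> \<open>The projection of \<open>M\<close> is a subsystem of the minimal set
    \<open>M'\<close>, hence equal to it; this places a point of \<open>M\<close> over
    \<open>y\<close>.\<close>
  have "minimal_set Y S (snd ` M)" by (rule minimal_set_image[OF P snd _ M(2)]) auto
  then have "subsystem Y S (snd ` M)" by (simp add: minimal_set_def)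
  moreover have "snd ` M \<subseteq> M'" using M(1) by auto
  ultimately have "snd ` M = M'" using M'(1) by (simp add: minimal_set_def)
  then obtain v where v: "(v, y) \<in> M" using M'(2) by force
  have "minimal_set X T (fst ` M)" by (rule minimal_set_image[OF P fst _ M(2)]) auto
  then have "minimal_point X T v" using v unfolding minimal_point_iff by force
  \<comment> \<open>The orbit of \<open>(x, x')\<close> enters each neighbourhood
    \<open>W \<times> V\<close> of \<open>(v, y)\<close>. A visit of \<open>x'\<close> to
    \<open>V\<close> is at the same time a visit of \<open>x\<close> to \<open>U\<close>, so
    \<open>W\<close> meets \<open>U\<close>.\<close>
  moreover have "v \<in> mtopology_of X closure_of U"
    unfolding in_closure_of
  proof (intro conjI allI impI)
    have vZ: "(v, y) \<in> Z" using M(1) v by blast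
    then show "v \<in> topspace (mtopology_of X)" using subsystem_subset[OF Z] by auto
    fix W assume W: "v \<in> W \<and> openin (mtopology_of X) W"
    then have "openin (mtopology_of ?P) (W \<times> V)" using *(3) by (simp add: openin_prod_Times_iff)
    moreover have "(v, y) \<in> W \<times> V" using W *(4) by simp
    ultimately have "\<exists>z. z \<in> range (\<lambda>n. (?R ^^ n) (x, x')) \<and> z \<in> W \<times> V"
      using vZ unfolding Z_def orbit_closure_def in_closure_of by (elim conjE allE[of _ "W \<times> V"]) simp
    then obtain n where "(?R ^^ n) (x, x') \<in> W \<times> V" by (elim exE conjE rangeE) simp
    then have "(T ^^ n) x \<in> W" "(T ^^ n) x \<in> U"
      using ret unfolding map_prod_funpow return_times_def by auto
    then show "\<exists>u. u \<in> U \<and> u \<in> W" by blast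
  qed
  ultimately show ?thesis by (rule that)
qed

section \<open>Weak mixing\<close>

lemma funpow_funpow:
  fixes T :: "'a \<Rightarrow> 'a"
  shows "(T ^^ m) ((T ^^ n) x) = (T ^^ (m + n)) x"
  by (simp add: funpow_add)

lemma hitting_timesI: "u \<in> U \<Longrightarrow> (T ^^ n) u \<in> V \<Longrightarrow> n \<in> hitting_times T U V"
  unfolding hitting_times_def by blast

lemma hitting_timesE:
  assumes "n \<in> hitting_times T U V"
  obtains u where "u \<in> U" "(T ^^ n) u \<in> V"
  using assms unfolding hitting_times_def by blast

lemma opene_Int_preimage_in:
  assumes tds: "tds X T" and U: "opene X U" and V: "opene X V" and n: "n \<in> hitting_times T U V"
  shows "opene X (U \<inter> preimage_in X T n V)"
proof -
  obtain u where "u \<in> U" "(T ^^ n) u \<in> V" using n by (rule hitting_timesE)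
  moreover have "U \<subseteq> mspace X" using U openin_subset unfolding opene_def by fastforce
  ultimately have "u \<in> U \<inter> preimage_in X T n V" by (auto simp: preimage_in_def)
  then show ?thesis using U V openin_preimage_in[OF tds, of V n] unfolding opene_def by blast
qed

lemma hitting_times_Times:
  fixes T :: "'a \<Rightarrow> 'a"
  shows "hitting_times (map_prod T T) (A \<times> C) (B \<times> D) = hitting_times T A B \<inter> hitting_times T C D"
proof (intro set_eqI iffI)
  fix n assume "n \<in> hitting_times (map_prod T T) (A \<times> C) (B \<times> D)"
  then obtain a c where "a \<in> A" "c \<in> C" "(map_prod T T ^^ n) (a, c) \<in> B \<times> D"
    by (elim hitting_timesE SigmaE) simp
  then show "n \<in> hitting_times T A B \<inter> hitting_times T C D"
    by (simp add: map_prod_funpow hitting_timesI)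
next
  fix n assume n: "n \<in> hitting_times T A B \<inter> hitting_times T C D"
  obtain a where "a \<in> A" "(T ^^ n) a \<in> B" using n by (elim IntE hitting_timesE)
  moreover obtain c where "c \<in> C" "(T ^^ n) c \<in> D" using n by (elim IntE hitting_timesE)
  ultimately show "n \<in> hitting_times (map_prod T T) (A \<times> C) (B \<times> D)"
    by (intro hitting_timesI[of "(a, c)"]) (simp_all add: map_prod_funpow)
qed

lemma hitting_times_mono: "U \<subseteq> U' \<Longrightarrow> V \<subseteq> V' \<Longrightarrow> hitting_times T U V \<subseteq> hitting_times T U' V'"
  unfolding hitting_times_def by blast

text \<open>Every nonempty open set of the product contains an open box, and the hitting times
  between boxes are intersections of hitting times in the factors.\<close>

lemma weakly_mixing_iff:
  "weakly_mixing X T \<longleftrightarrow> (\<forall>A B C D. opene X A \<longrightarrow> opene X B \<longrightarrow> opene X C \<longrightarrow> opene X D \<longrightarrow>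
     infinite (hitting_times T A B \<inter> hitting_times T C D))"
proof (intro iffI allI impI)
  fix A B C D assume wm: "weakly_mixing X T" and "opene X A" "opene X B" "opene X C" "opene X D"
  then have "opene (prod_metric X X) (A \<times> C)" "opene (prod_metric X X) (B \<times> D)"
    by (simp_all add: opene_def openin_prod_Times_iff)
  then show "infinite (hitting_times T A B \<inter> hitting_times T C D)"
    using wm hitting_times_Times unfolding weakly_mixing_def transitive_tds_def by metis
next
  assume R: "\<forall>A B C D. opene X A \<longrightarrow> opene X B \<longrightarrow> opene X C \<longrightarrow> opene X D \<longrightarrow>
     infinite (hitting_times T A B \<inter> hitting_times T C D)"
  have box: "\<exists>A C. opene X A \<and> opene X C \<and> A \<times> C \<subseteq> P" if P: "opene (prod_metric X X) P" for P
  proof -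
    obtain a c where ac: "(a, c) \<in> P" using P by (auto simp: opene_def)
    have "openin (prod_topology (mtopology_of X) (mtopology_of X)) P" using P by (simp add: opene_def)
    then have "\<exists>A C. openin (mtopology_of X) A \<and> openin (mtopology_of X) C \<and> a \<in> A \<and> c \<in> C \<and> A \<times> C \<subseteq> P"
      using ac unfolding openin_prod_topology_alt by simp
    then show ?thesis unfolding opene_def by blast
  qed
  show "weakly_mixing X T"
    unfolding weakly_mixing_def transitive_tds_def
  proof (intro allI impI)
    fix P Q assume "opene (prod_metric X X) P" "opene (prod_metric X X) Q"
    then obtain A B C D where *: "opene X A" "opene X C" "A \<times> C \<subseteq> P" "opene X B" "opene X D" "B \<times> D \<subseteq> Q"
      using box[of P] box[of Q] by blast
    then have "infinite (hitting_times T A B \<inter> hitting_times T C D)" using R by simp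
    moreover have "hitting_times T A B \<inter> hitting_times T C D \<subseteq> hitting_times (map_prod T T) P Q"
      using hitting_times_mono[OF *(3,6), of "map_prod T T"] by (simp add: hitting_times_Times)
    ultimately show "infinite (hitting_times (map_prod T T) P Q)" using finite_subset by blast
  qed
qed

lemma weakly_mixing_imp_transitive: "weakly_mixing X T \<Longrightarrow> transitive_tds X T"
  unfolding weakly_mixing_iff transitive_tds_def by (metis Int_absorb)

text \<open>\<open>A\<close> is shrunk twice, so that its points visit \<open>C\<close> at time \<open>m\<close> and \<open>B\<close> at time \<open>a\<close>; for
  \<open>A2\<close> obtained this way, a common element \<open>k\<close> of \<open>N(A2, A2)\<close> and \<open>N(A2, preimage_in X T (a + m) D)\<close> yields the time \<open>a + k\<close>.\<close>

lemma weakly_mixing_criterion: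
  assumes tds: "tds X T"
    and surj: "\<And>n V. opene X V \<Longrightarrow> opene X (preimage_in X T n V)"
    and meet: "\<And>U V. opene X U \<Longrightarrow> opene X V \<Longrightarrow> \<exists>k. k \<in> hitting_times T U U \<and> k \<in> hitting_times T U V"
  shows "weakly_mixing X T"
proof -
  have step: "\<exists>n. opene X (U \<inter> preimage_in X T n V)" if U: "opene X U" and V: "opene X V" for U V
  proof -
    obtain n where "n \<in> hitting_times T U V" using meet[OF U V] by blast
    then show ?thesis using opene_Int_preimage_in[OF tds U V] by blast
  qed
  have meet4: "\<exists>k. k \<in> hitting_times T A B \<and> k \<in> hitting_times T C D"
    if o: "opene X A" "opene X B" "opene X C" "opene X D" for A B C D
  proof -
    obtain m where m: "opene X (A \<inter> preimage_in X T m C)" using step[OF o(1,3)] by blast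
    define A1 where "A1 = A \<inter> preimage_in X T m C"
    obtain a where a: "opene X (A1 \<inter> preimage_in X T a B)" using step[OF m o(2)] unfolding A1_def by blast
    define A2 where "A2 = A1 \<inter> preimage_in X T a B"
    obtain k where k: "k \<in> hitting_times T A2 A2" "k \<in> hitting_times T A2 (preimage_in X T (a + m) D)"
      using meet[OF a surj[OF o(4), of "a + m"]] unfolding A2_def by blast
    obtain p where p: "p \<in> A2" "(T ^^ k) p \<in> A2" using k(1) by (rule hitting_timesE)
    obtain q where q: "q \<in> A2" "(T ^^ k) q \<in> preimage_in X T (a + m) D" using k(2) by (rule hitting_timesE)
    have "(T ^^ (a + k)) p \<in> B" using p(2) by (simp add: A2_def preimage_in_def funpow_add)
    then have 1: "a + k \<in> hitting_times T A B" using p(1) by (intro hitting_timesI) (auto simp: A1_def A2_def)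
    \<comment> \<open>The witness starting in \<open>C\<close> is \<open>(T ^^ m) q\<close>; the
      extra \<open>m\<close> in the preimage of \<open>D\<close> accounts for the passage from
      \<open>q\<close> to it.\<close>
    have "(T ^^ (a + m + k)) q \<in> D" using q(2) by (simp add: preimage_in_def funpow_add)
    then have "(T ^^ (a + k)) ((T ^^ m) q) \<in> D"
      by (simp add: funpow_funpow ac_simps)
    moreover have "(T ^^ m) q \<in> C" using q(1) by (simp add: A1_def A2_def preimage_in_def)
    ultimately have "a + k \<in> hitting_times T C D" by (intro hitting_timesI)
    with 1 show ?thesis by blast
  qed
  \<comment> \<open>Replacing the targets by their preimages under \<open>T ^^ N\<close> shifts a
    common time beyond \<open>N\<close>, which upgrades nonempty to infinite.\<close>
  have "\<exists>k\<ge>N. k \<in> hitting_times T A B \<inter> hitting_times T C D"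
    if o: "opene X A" "opene X B" "opene X C" "opene X D" for A B C D N
  proof -
    obtain k where k: "k \<in> hitting_times T A (preimage_in X T N B)" "k \<in> hitting_times T C (preimage_in X T N D)"
      using meet4[OF o(1) surj[OF o(2), of N] o(3) surj[OF o(4), of N]] by blast
    have *: "N + k \<in> hitting_times T U V" if "k \<in> hitting_times T U (preimage_in X T N V)" for U V
      using that by (elim hitting_timesE) (auto simp: preimage_in_def funpow_add intro: hitting_timesI)
    show ?thesis using *[OF k(1)] *[OF k(2)] by (intro exI[of _ "N + k"]) simp
  qed
  then show ?thesis unfolding weakly_mixing_iff infinite_nat_iff_unbounded_le by simp
qed

text \<open>A syndetic set meets one of its translates by \<open>s 0, \<dots>, s g\<close> in another: pigeonhole on the
  offsets \<open>r i\<close>, bounded by the gap length \<open>g\<close>.\<close>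

lemma F_cen_meets_self_hitting_times:
  assumes tds: "tds X T" and U: "openin (mtopology_of X) U" and v: "minimal_point X T v" "v \<in> U"
    and F: "F \<in> F_cen"
  shows "\<exists>k\<in>F. k \<in> hitting_times T U U"
proof -
  obtain M where M: "minimal_set X T M" "v \<in> M" using v(1) unfolding minimal_point_iff by blast
  have sM: "subsystem X T M" using M by (simp add: minimal_set_def)
  have "U \<inter> M \<noteq> {}" using v(2) M(2) by blast
  then obtain g where g: "\<And>y. y \<in> M \<Longrightarrow> \<exists>r<g. (T ^^ r) y \<in> U"
    using minimal_set_syndetic[OF tds M(1) U] by blast
  obtain s :: "nat \<Rightarrow> nat" where s: "\<And>i j. j \<le> g \<Longrightarrow> i < j \<Longrightarrow> s i < s j \<and> s j - s i \<in> F"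
    using F_cen_differences[OF F, of g] by auto
  \<comment> \<open>Counting backwards from \<open>s g\<close> keeps the natural subtraction exact
    for \<open>i \<le> g\<close>. These orbit points lie in \<open>M\<close>, so each reaches
    \<open>U\<close> in fewer than \<open>g\<close> steps.\<close>
  have "\<exists>r<g. (T ^^ r) ((T ^^ (s g - s i)) v) \<in> U" for i
    by (rule g) (rule subsystem_funpow[OF sM M(2)])
  then obtain r where r: "\<And>i. r i < g" "\<And>i. (T ^^ (r i)) ((T ^^ (s g - s i)) v) \<in> U" by metis
  have "\<not> inj_on r {..g}"
  proof
    assume "inj_on r {..g}"
    moreover have "r ` {..g} \<subseteq> {..<g}" using r(1) by auto
    ultimately have "card {..g} \<le> card {..<g}" by (intro card_inj_on_le) auto
    then show False by simp
  qed
  then obtain i j where ij: "i < j" "j \<le> g" "r i = r j"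
    unfolding inj_on_def by (metis atMost_iff linorder_neqE_nat)
  have "s j \<le> s g" using s[of g j] ij by (cases "j = g") auto
  then have "s g - s i = (s j - s i) + (s g - s j)" using s[OF ij(2,1)] by simp
  \<comment> \<open>With equal offsets the two visits of \<open>v\<close> to \<open>U\<close> are
    exactly \<open>s j - s i\<close> steps apart, so this difference takes a point of
    \<open>U\<close> back into \<open>U\<close>.\<close>
  then have "(T ^^ (s j - s i)) ((T ^^ (r j + (s g - s j))) v) = (T ^^ (r i)) ((T ^^ (s g - s i)) v)"
    using ij(3) by (simp add: funpow_funpow ac_simps)
  then have "(T ^^ (s j - s i)) ((T ^^ (r j + (s g - s j))) v) \<in> U" using r(2) by simp
  moreover have "(T ^^ (r j + (s g - s j))) v \<in> U" using r(2)[of j] by (simp add: funpow_add)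
  ultimately have "s j - s i \<in> hitting_times T U U" by (intro hitting_timesI)
  then show ?thesis using s[OF ij(2,1)] by blast
qed

text \<open>Centrality of the return times to a set yields a minimal point only in its closure;
  shrinking the set first puts that point into the original open set.\<close>

lemma opene_closure_subset:
  assumes "opene X U"
  obtains U' where "opene X U'" "mtopology_of X closure_of U' \<subseteq> U"
proof -
  interpret Metric_space "mspace X" "mdist X" by simp
  have U: "openin mtopology U" using assms by (simp add: opene_def mtopology_of_def)
  obtain u where u: "u \<in> U" using assms by (auto simp: opene_def)
  then obtain r where r: "0 < r" "mcball u r \<subseteq> U" using U unfolding openin_mtopology_mcball by blast
  have "u \<in> mspace X" using U u openin_subset by fastforce
  then have "opene X (mball u r)" using r(1) by (auto simp: opene_def mtopology_of_def)
  moreover have "mtopology_of X closure_of mball u r \<subseteq> mcball u r"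
    unfolding mtopology_of_def by (rule closure_of_minimal) (auto simp: mball_subset_mcball)
  ultimately show ?thesis using that r(2) by blast
qed

section \<open>From one \<open>F_cen\<close>-transitive point to weak mixing and dense minimal
  points\<close>

lemma F_cen_trans_point_imp:
  assumes tds: "tds X T" and x: "x \<in> trans_points F_cen X T"
  shows "weakly_mixing X T" "M_system X T"
proof -
  have xX: "x \<in> mspace X" and ret: "\<And>U. opene X U \<Longrightarrow> return_times T x U \<in> F_cen"
    using x by (auto simp: trans_points_def)
  \<comment> \<open>The visits of \<open>x\<close> to \<open>V\<close> are unbounded; going back
    \<open>n\<close> steps along the orbit from a late visit gives a point of the preimage.\<close>
  have surj: "opene X (preimage_in X T n V)" if V: "opene X V" for n V
  proof -
    obtain m where m: "m \<ge> n" "(T ^^ m) x \<in> V"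
      using F_cen_unbounded[OF ret[OF V], of n] by (auto simp: return_times_def)
    then have "(T ^^ n) ((T ^^ (m - n)) x) \<in> V"
      by (simp add: funpow_funpow)
    then have "(T ^^ (m - n)) x \<in> preimage_in X T n V"
      using funpow_in_mspace[OF tds xX] by (simp add: preimage_in_def)
    then show ?thesis using V openin_preimage_in[OF tds] unfolding opene_def by blast
  qed
  have min: "\<exists>v\<in>U. minimal_point X T v" if "opene X U" for U
  proof -
    obtain U' where U': "opene X U'" "mtopology_of X closure_of U' \<subseteq> U"
      by (rule opene_closure_subset[OF \<open>opene X U\<close>])
    obtain v where "minimal_point X T v" "v \<in> mtopology_of X closure_of U'"
      by (rule F_cen_return_minimal_point[OF tds xX ret[OF U'(1)]])
    then show ?thesis using U'(2) by blast
  qed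
  show wm: "weakly_mixing X T"
  proof (rule weakly_mixing_criterion[OF tds surj])
    fix U V assume U: "opene X U" and V: "opene X V"
    obtain m where m: "(T ^^ m) x \<in> U"
      using F_cen_unbounded[OF ret[OF U], of 0] by (auto simp: return_times_def)
    obtain v where v: "v \<in> U" "minimal_point X T v" using min[OF U] by blast
    have "openin (mtopology_of X) U" using U by (simp add: opene_def)
    \<comment> \<open>The central set used consists of the \<open>k\<close> with
      \<open>(T ^^ (m + k)) x\<close> in \<open>V\<close>: each such \<open>k\<close> carries the
      point \<open>(T ^^ m) x\<close> of \<open>U\<close> into \<open>V\<close>.\<close>
    from F_cen_meets_self_hitting_times[OF tds this v(2,1) ret[OF surj[OF V, of m]]]
    obtain k where k: "k \<in> return_times T x (preimage_in X T m V)" "k \<in> hitting_times T U U"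
      by (elim bexE)
    have "(T ^^ k) ((T ^^ m) x) \<in> V"
      using k(1) by (simp add: return_times_def preimage_in_def funpow_funpow ac_simps)
    then have "k \<in> hitting_times T U V" using m by (intro hitting_timesI)
    with k(2) show "\<exists>k. k \<in> hitting_times T U U \<and> k \<in> hitting_times T U V" by blast
  qed
  have "mspace X \<subseteq> mtopology_of X closure_of {x. minimal_point X T x}"
  proof
    fix y assume y: "y \<in> mspace X"
    show "y \<in> mtopology_of X closure_of {x. minimal_point X T x}"
      unfolding in_closure_of
    proof (intro conjI allI impI)
      fix U assume "y \<in> U \<and> openin (mtopology_of X) U"
      then have "opene X U" by (auto simp: opene_def)
      then show "\<exists>z. z \<in> {x. minimal_point X T x} \<and> z \<in> U" using min by blast
    qed (use y in simp)
  qed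
  then have "mtopology_of X closure_of {x. minimal_point X T x} = mspace X"
    using closure_of_subset_topspace[of "mtopology_of X"] by fastforce
  then show "M_system X T" using weakly_mixing_imp_transitive[OF wm] by (simp add: M_system_def)
qed

section \<open>Proximal cells\<close>

text \<open>Furstenberg's intersection argument, by induction on the family. If a time
  \<open>n\<close> takes \<open>E\<close> to \<open>U\<close> and \<open>F\<close> to
  \<open>V\<close>, restrict both to the points that do so. When \<open>p\<close> moves from the
  smaller \<open>E\<close> to the smaller \<open>F\<close> in \<open>k\<close> steps,
  \<open>(T ^^ n) p\<close> moves from \<open>U\<close> to \<open>V\<close> in \<open>k\<close>
  steps, as iterates commute.\<close>

lemma weakly_mixing_common_hitting_times:
  assumes tds: "tds X T" and wm: "weakly_mixing X T" and U: "opene X U"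
    and \<V>: "finite \<V>" "\<And>V. V \<in> \<V> \<Longrightarrow> opene X V"
  shows "\<exists>E F. opene X E \<and> opene X F \<and> (\<forall>V\<in>\<V>. hitting_times T E F \<subseteq> hitting_times T U V)"
  using \<V>
proof (induction \<V>)
  case empty
  then show ?case using U by blast
next
  case (insert V \<V>)
  then obtain E F where E: "opene X E" and F: "opene X F"
    and sub: "\<And>V. V \<in> \<V> \<Longrightarrow> hitting_times T E F \<subseteq> hitting_times T U V" by auto
  have V: "opene X V" using insert.prems by simp
  have "infinite (hitting_times T E U \<inter> hitting_times T F V)"
    using wm E F U V unfolding weakly_mixing_iff by simp
  then obtain n where n: "n \<in> hitting_times T E U" "n \<in> hitting_times T F V"
    using infinite_imp_nonempty by blast
  let ?E = "E \<inter> preimage_in X T n U" and ?F = "F \<inter> preimage_in X T n V"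
  have "hitting_times T ?E ?F \<subseteq> hitting_times T E F"
    by (rule hitting_times_mono) auto
  moreover have "hitting_times T ?E ?F \<subseteq> hitting_times T U V"
  proof
    fix k assume "k \<in> hitting_times T ?E ?F"
    then obtain p where p: "p \<in> ?E" "(T ^^ k) p \<in> ?F" by (rule hitting_timesE)
    then have "(T ^^ k) ((T ^^ n) p) \<in> V" by (simp add: preimage_in_def funpow_funpow add.commute)
    then show "k \<in> hitting_times T U V" using p(1) by (intro hitting_timesI) (auto simp: preimage_in_def)
  qed
  ultimately have "\<forall>W\<in>insert V \<V>. hitting_times T ?E ?F \<subseteq> hitting_times T U W"
    using sub by blast
  then show ?case using opene_Int_preimage_in[OF tds E U n(1)] opene_Int_preimage_in[OF tds F V n(2)] by blast
qed

lemma finite_ball_cover: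
  assumes "tds X T" "0 < \<epsilon>"
  obtains K where "finite K" "K \<subseteq> mspace X" "mspace X \<subseteq> (\<Union>x\<in>K. mball_of X x \<epsilon>)"
proof -
  interpret Metric_space "mspace X" "mdist X" by simp
  have "mtotally_bounded (mspace X)"
    using assms(1) by (simp add: tds_def mtopology_of_def compact_space_eq_mcomplete_mtotally_bounded)
  then have "\<exists>K. finite K \<and> K \<subseteq> mspace X \<and> mspace X \<subseteq> (\<Union>x\<in>K. mball x \<epsilon>)"
    using assms(2) unfolding mtotally_bounded_def by auto
  then show ?thesis using that by (auto simp: mball_of_def)
qed

lemma opene_mball_of: "x \<in> mspace X \<Longrightarrow> 0 < \<epsilon> \<Longrightarrow> opene X (mball_of X x \<epsilon>)"
  using Metric_space.openin_mball[of "mspace X" "mdist X" x \<epsilon>]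
  by (auto simp: opene_def mtopology_of_def mball_of_def Metric_space.mball_eq_empty)

lemma opene_contains_mball_of:
  assumes "openin (mtopology_of X) U" "u \<in> U"
  obtains \<epsilon> where "0 < \<epsilon>" "mball_of X u \<epsilon> \<subseteq> U"
  using assms Metric_space.openin_mtopology[of "mspace X" "mdist X" U]
  by (auto simp: mtopology_of_def mball_of_def)

text \<open>Compactness gives the orbit of \<open>x\<close> a limit along a subsequence of the
  times; the orbit of \<open>y\<close> follows because the distances tend to zero.\<close>

lemma proximalI:
  assumes tds: "tds X T" and xy: "x \<in> mspace X" "y \<in> mspace X"
    and close: "\<And>i. \<exists>n>0. mdist X ((T ^^ n) x) ((T ^^ n) y) < inverse (Suc i)"
  shows "proximal X T x y"
proof -
  interpret Metric_space "mspace X" "mdist X" by simp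
  obtain n where n: "\<And>i. 0 < n i" "\<And>i. mdist X ((T ^^ n i) x) ((T ^^ n i) y) < inverse (Suc i)"
    using close by metis
  have X: "(T ^^ i) x \<in> mspace X" "(T ^^ i) y \<in> mspace X" for i
    using funpow_in_mspace[OF tds] xy by blast+
  have "compact_space mtopology" using tds by (simp add: tds_def mtopology_of_def)
  moreover have "range (\<lambda>i. (T ^^ n i) x) \<subseteq> mspace X" using X by blast
  ultimately obtain z r where r: "strict_mono (r :: nat \<Rightarrow> nat)"
    and lx: "limitin mtopology ((\<lambda>i. (T ^^ n i) x) \<circ> r) z sequentially"
    unfolding compact_space_sequentially by blast
  have z: "z \<in> mspace X" using lx limitin_mspace by blast
  have "limitin mtopology (\<lambda>i. (T ^^ n (r i)) y) z sequentially"
    unfolding limit_metric_sequentially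
  proof (intro conjI allI impI)
    fix \<epsilon> :: real assume \<epsilon>: "0 < \<epsilon>"
    then have "0 < \<epsilon> / 2" by simp
    then obtain N where N: "\<And>i. i \<ge> N \<Longrightarrow> mdist X ((T ^^ n (r i)) x) z < \<epsilon> / 2"
      using lx unfolding limit_metric_sequentially o_def by meson
    obtain K where K: "inverse (Suc K) < \<epsilon> / 2" using reals_Archimedean[OF \<open>0 < \<epsilon> / 2\<close>] by blast
    have "mdist X ((T ^^ n (r i)) y) z < \<epsilon>" if "i \<ge> max N K" for i
    proof -
      \<comment> \<open>A strictly increasing \<open>r\<close> satisfies \<open>i \<le> r i\<close>,
        so the bound on the distances survives the passage to the subsequence.\<close>
      have "K \<le> r i" using that seq_suble[OF r, of i] by simp
      then have "inverse (real (Suc (r i))) \<le> inverse (real (Suc K))" by (intro le_imp_inverse_le) auto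
      then have "mdist X ((T ^^ n (r i)) x) ((T ^^ n (r i)) y) < \<epsilon> / 2" using n(2)[of "r i"] K by linarith
      moreover have "mdist X ((T ^^ n (r i)) x) z < \<epsilon> / 2" using N that by simp
      ultimately show ?thesis
        using triangle[OF X(2) X(1) z, of "n (r i)" "n (r i)"] commute[of "(T ^^ n (r i)) x"] by fastforce
    qed
    then show "\<exists>N. \<forall>i\<ge>N. (T ^^ n (r i)) y \<in> mspace X \<and> mdist X ((T ^^ n (r i)) y) z < \<epsilon>"
      using X(2) by blast
  qed (rule z)
  then show ?thesis
    unfolding proximal_def using xy lx n(1)
    by (intro conjI exI[of _ "n \<circ> r"] exI[of _ z]) (simp_all add: mtopology_of_def o_def)
qed

text \<open>An open approximation to the proximal cell of \<open>y\<close>: by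
  \<open>proximalI\<close>, a point in these sets for all tolerances \<open>inverse (Suc i)\<close>
  is proximal to \<open>y\<close>.\<close>

definition near_cell :: "'a metric \<Rightarrow> ('a \<Rightarrow> 'a) \<Rightarrow> 'a \<Rightarrow> real \<Rightarrow> 'a set" where
  "near_cell X T y \<epsilon> = {x \<in> mspace X. \<exists>n>0. mdist X ((T ^^ n) x) ((T ^^ n) y) < \<epsilon>}"

lemma openin_near_cell:
  assumes tds: "tds X T" and y: "y \<in> mspace X" and \<epsilon>: "0 < \<epsilon>"
  shows "openin (mtopology_of X) (near_cell X T y \<epsilon>)"
proof -
  have "near_cell X T y \<epsilon> = (\<Union>n\<in>{0<..}. preimage_in X T n (mball_of X ((T ^^ n) y) \<epsilon>))"
    using funpow_in_mspace[OF tds] y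
    by (auto simp: near_cell_def preimage_in_def mdist_commute)
  moreover have "openin (mtopology_of X) (preimage_in X T n (mball_of X ((T ^^ n) y) \<epsilon>))" for n
    using openin_preimage_in[OF tds] opene_mball_of[OF funpow_in_mspace[OF tds y] \<epsilon>]
    unfolding opene_def by blast
  ultimately show ?thesis by auto
qed

text \<open>Some \<open>n\<close> lies in \<open>N(U, V)\<close> for all members \<open>V\<close> of a cover by small balls at once, in particular
  for the one containing \<open>T\<^sup>n y\<close>.\<close>

lemma dense_near_cell:
  assumes tds: "tds X T" and wm: "weakly_mixing X T" and y: "y \<in> mspace X" and \<epsilon>: "0 < \<epsilon>"
  shows "mtopology_of X closure_of near_cell X T y \<epsilon> = mspace X"
proof -
  have "near_cell X T y \<epsilon> \<inter> U \<noteq> {}" if U: "opene X U" for U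
  proof -
    obtain K where K: "finite K" "K \<subseteq> mspace X" "mspace X \<subseteq> (\<Union>x\<in>K. mball_of X x (\<epsilon> / 2))"
      using finite_ball_cover[OF tds, of "\<epsilon> / 2"] \<epsilon> by auto
    have "opene X V" if "V \<in> (\<lambda>x. mball_of X x (\<epsilon> / 2)) ` K" for V
      using that K(2) \<epsilon> opene_mball_of[of _ X "\<epsilon> / 2"] by auto
    then obtain E F where "opene X E" "opene X F"
      and EF: "\<forall>V\<in>(\<lambda>x. mball_of X x (\<epsilon> / 2)) ` K. hitting_times T E F \<subseteq> hitting_times T U V"
      using weakly_mixing_common_hitting_times[OF tds wm U finite_imageI[OF K(1)]] by metis
    \<comment> \<open>Infinitely many common times ensure a positive one, as
      \<open>near_cell\<close> demands.\<close>
    then have "infinite (hitting_times T E F)"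
      using weakly_mixing_imp_transitive[OF wm] unfolding transitive_tds_def by simp
    then obtain n where n: "n > 0" "n \<in> hitting_times T E F"
      unfolding infinite_nat_iff_unbounded by blast
    have Ty: "(T ^^ n) y \<in> mspace X" by (rule funpow_in_mspace[OF tds y])
    then obtain k where k: "k \<in> K" "mdist X k ((T ^^ n) y) < \<epsilon> / 2" using K(3) by fastforce
    have "n \<in> hitting_times T U (mball_of X k (\<epsilon> / 2))" using EF k(1) n(2) by blast
    then obtain u where u: "u \<in> U" "(T ^^ n) u \<in> mball_of X k (\<epsilon> / 2)" by (rule hitting_timesE)
    have "mdist X ((T ^^ n) u) ((T ^^ n) y) \<le> mdist X ((T ^^ n) u) k + mdist X k ((T ^^ n) y)"
      using u(2) Ty by (intro mdist_triangle) auto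
    also have "\<dots> < \<epsilon>" using u(2) k(2) mdist_commute[of X k "(T ^^ n) u"] by simp
    finally have "mdist X ((T ^^ n) u) ((T ^^ n) y) < \<epsilon>" .
    moreover have "u \<in> mspace X" using U u(1) openin_subset unfolding opene_def by fastforce
    ultimately have "u \<in> near_cell X T y \<epsilon>" using n(1) unfolding near_cell_def by blast
    then show ?thesis using u(1) by blast
  qed
  then show ?thesis
    using dense_intersects_open[of "mtopology_of X"] by (simp add: opene_def)
qed

text \<open>Compactness gives a finite net at each scale \<open>\<delta> n\<close>; moving every net
  point to a minimal point within \<open>\<delta> n\<close> keeps the union of the nets
  dense.\<close>

lemma countable_dense_minimal_points:
  assumes tds: "tds X T" and dense: "mtopology_of X closure_of {x. minimal_point X T x} = mspace X"
  obtains D where "countable D" "\<And>y. y \<in> D \<Longrightarrow> minimal_point X T y"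
    "\<And>U. opene X U \<Longrightarrow> D \<inter> U \<noteq> {}"
proof -
  define \<delta> :: "nat \<Rightarrow> real" where "\<delta> = (\<lambda>n. inverse (Suc n))"
  have \<delta>: "0 < \<delta> n" for n by (simp add: \<delta>_def)
  have "\<exists>K. finite K \<and> K \<subseteq> mspace X \<and> mspace X \<subseteq> (\<Union>x\<in>K. mball_of X x (\<delta> n))" for n
    using finite_ball_cover[OF tds \<delta>[of n]] by metis
  then obtain K where K: "\<And>n. finite (K n)" "\<And>n. K n \<subseteq> mspace X"
    "\<And>n. mspace X \<subseteq> (\<Union>x\<in>K n. mball_of X x (\<delta> n))" by metis
  have "\<exists>y. minimal_point X T y \<and> y \<in> mball_of X x (\<delta> n)" if "x \<in> mspace X" for x n
  proof -
    have "{x. minimal_point X T x} \<inter> mball_of X x (\<delta> n) \<noteq> {}"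
      using dense dense_intersects_open[of "mtopology_of X" "{x. minimal_point X T x}"]
        opene_mball_of[OF that \<delta>[of n]] by (simp add: opene_def)
    then show ?thesis by blast
  qed
  then obtain p where p: "\<And>x n. x \<in> mspace X \<Longrightarrow> minimal_point X T (p x n)"
    "\<And>x n. x \<in> mspace X \<Longrightarrow> p x n \<in> mball_of X x (\<delta> n)" by metis
  show ?thesis
  proof
    show "countable (\<Union>n. (\<lambda>x. p x n) ` K n)" using K(1) by (simp add: countable_finite)
    show "minimal_point X T y" if "y \<in> (\<Union>n. (\<lambda>x. p x n) ` K n)" for y
      using that p(1) K(2) by blast
    show "(\<Union>n. (\<lambda>x. p x n) ` K n) \<inter> U \<noteq> {}" if U: "opene X U" for U
    proof -
      obtain u where u: "u \<in> U" using U by (auto simp: opene_def)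
      have uX: "u \<in> mspace X" using U u openin_subset unfolding opene_def by fastforce
      obtain \<epsilon> where \<epsilon>: "0 < \<epsilon>" "mball_of X u \<epsilon> \<subseteq> U"
        using opene_contains_mball_of[of X U u] U u unfolding opene_def by blast
      \<comment> \<open>Half of \<open>\<epsilon>\<close> is spent on reaching the net point
        \<open>k\<close>, the other half on going from \<open>k\<close> to its minimal substitute
        \<open>p k n\<close>.\<close>
      then obtain n where n: "\<delta> n < \<epsilon> / 2" using reals_Archimedean[of "\<epsilon> / 2"] unfolding \<delta>_def by auto
      obtain k where k: "k \<in> K n" "mdist X k u < \<delta> n" using K(3)[of n] uX by fastforce
      have kX: "k \<in> mspace X" using K(2) k(1) by blast
      have pk: "p k n \<in> mspace X" "mdist X k (p k n) < \<delta> n" using p(2)[OF kX, of n] by auto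
      have "mdist X u (p k n) \<le> mdist X u k + mdist X k (p k n)" by (rule mdist_triangle[OF uX kX pk(1)])
      also have "\<dots> < \<epsilon>" using k(2) pk(2) n mdist_commute[of X u k] by linarith
      finally have "p k n \<in> mball_of X u \<epsilon>" using uX pk(1) by simp
      then show ?thesis using \<epsilon>(2) k(1) by blast
    qed
  qed
qed

section \<open>Residuality by the Baire category theorem\<close>

lemma weakly_mixing_M_system_residual:
  assumes tds: "tds X T" and wm: "weakly_mixing X T" and M: "M_system X T"
  shows "residual_in X (trans_points F_cen X T)"
proof -
  obtain D where D: "countable D" "\<And>y. y \<in> D \<Longrightarrow> minimal_point X T y"
    "\<And>U. opene X U \<Longrightarrow> D \<inter> U \<noteq> {}"
    using countable_dense_minimal_points[OF tds] M unfolding M_system_def by metis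
  have DX: "y \<in> mspace X" if "y \<in> D" for y
    using D(2)[OF that] subsystem_subset unfolding minimal_point_def by blast
  \<comment> \<open>There is one cell for each \<open>y\<close> in \<open>D\<close> and each
    tolerance, so the family is countable and a point in all its members is proximal to every
    \<open>y\<close> in \<open>D\<close>.\<close>
  define \<G> where "\<G> = (\<lambda>(y, i). near_cell X T y (inverse (Suc i))) ` (D \<times> UNIV)"
  have "opene X (mspace X)"
    using tds openin_topspace[of "mtopology_of X"] by (simp add: opene_def tds_def)
  \<comment> \<open>Nonemptiness keeps the intersection of the family inside the carrier.\<close>
  then have "D \<noteq> {}" using D(3) by blast
  then have ne: "\<G> \<noteq> {}" by (simp add: \<G>_def)
  have cG: "countable \<G>" unfolding \<G>_def using D(1) by simp
  have op: "openin (mtopology_of X) G" and de: "mtopology_of X closure_of G = mspace X" if "G \<in> \<G>" for G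
    using that openin_near_cell[OF tds DX] dense_near_cell[OF tds wm DX] by (auto simp: \<G>_def)
  interpret Metric_space "mspace X" "mdist X" by simp
  have "mcomplete" using tds compact_space_imp_mcomplete by (simp add: tds_def mtopology_of_def)
  then have dense: "mtopology_of X closure_of \<Inter>\<G> = mspace X"
    using metric_Baire_category[of \<G>] cG op de by (simp add: mtopology_of_def)
  have gdelta: "gdelta_in (mtopology_of X) (\<Inter>\<G>)"
    using cG ne op by (intro gdelta_in_Inter) (auto intro: open_imp_gdelta_in)
  have "x \<in> trans_points F_cen X T" if x: "x \<in> \<Inter>\<G>" for x
    unfolding trans_points_def
  proof (intro CollectI conjI allI impI)
    show xX: "x \<in> mspace X" using x gdelta gdelta_in_subset by fastforce
    fix U assume U: "opene X U"
    then obtain y where y: "y \<in> D" "y \<in> U" using D(3)[OF U] by blast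
    have "x \<in> near_cell X T y (inverse (Suc i))" for i using x y(1) by (auto simp: \<G>_def)
    then have "proximal X T x y" by (intro proximalI[OF tds xX DX[OF y(1)]]) (simp add: near_cell_def)
    moreover have "openin (mtopology_of X) U" "U \<subseteq> mspace X"
      using U openin_subset unfolding opene_def by fastforce+
    \<comment> \<open>The system \<open>X\<close> itself witnesses centrality, with \<open>U\<close>
      as the neighbourhood of the minimal point \<open>y\<close>; \<open>central_inI\<close> then
      transfers this to the point type used in \<open>F_cen\<close>.\<close>
    ultimately have "central_in X T (return_times T x U)"
      unfolding central_in_def using xX D(2)[OF y(1)] y(2) by blast
    then show "return_times T x U \<in> F_cen" by (rule central_inI[OF tds])
  qed
  then have "\<Inter>\<G> \<subseteq> trans_points F_cen X T" by blast
  then show ?thesis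
    unfolding residual_in_def using dense gdelta by (auto simp: trans_points_def)
qed

theorem theorem3p7:
  fixes X :: "'a metric" and T :: "'a \<Rightarrow> 'a"
  assumes "tds X T"
  shows "(weakly_mixing X T \<and> M_system X T \<longleftrightarrow> residual_in X (trans_points F_cen X T)) \<and>
         (residual_in X (trans_points F_cen X T) \<longleftrightarrow> point_transitive F_cen X T)"
proof -
  have "point_transitive F_cen X T" if "residual_in X (trans_points F_cen X T)"
  proof -
    obtain G where "mtopology_of X closure_of G = mspace X" "G \<subseteq> trans_points F_cen X T"
      using \<open>residual_in X (trans_points F_cen X T)\<close> unfolding residual_in_def by auto
    moreover have "mspace X \<noteq> {}" using assms by (simp add: tds_def)
    ultimately show ?thesis unfolding point_transitive_def by (metis closure_of_empty subset_empty)
  qed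
  moreover have "weakly_mixing X T \<and> M_system X T" if "point_transitive F_cen X T"
    using that F_cen_trans_point_imp[OF assms] unfolding point_transitive_def by blast
  \<comment> \<open>The three implications (1) to (2), (2) to (3) and (3) to (1) close the
    cycle.\<close>
  ultimately show ?thesis using weakly_mixing_M_system_residual[OF assms] by blast
qed

end
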